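(* Let $n\ge2$ be an integer and let $t$ be an even natural number. Suppose that $b_{n,t}$ is a natural number and that $X$ is a spherical design of harmonic index $t$ on $S^{n-1}$ with $|X|=b_{n,t}$. Then there exists some $\alpha\in[-1,1]$ such that $I(X)=\{\pm\alpha\}$.
   Context: $S^{n-1}$ denotes the unit sphere centered at the origin in $\mathbb{R}^n$ and $\langle\cdot,\cdot\rangle$ the standard inner product. $\mathrm{Harm}_t(\mathbb{R}^n)$ is the space of real homogeneous polynomials $f$ of degree $t$ in $n$ variables with $\Delta f=0$, where $\Delta=\sum_i\partial^2/\partial x_i^2$. A finite nonempty subset $X\subset S^{n-1}$ is a spherical design of harmonic index $t$ if $\sum_{x\in X}f(x)=0$ for every $f\in\mathrm{Harm}_t(\mathbb{R}^n)$. For a finite subset $X$ of the sphere, $I(X)=\{\langle x,y\rangle\mid x,y\in X,\ x\neq y\}$. $Q_{n,t}$: let $C_t^\lambda(x)$ be the Gegenbauer polynomial of degree $t$, defined for $\lambda\ne0$ by $(1-2xr+r^2)^{-\lambda}=\sum_{t\ge0}C_t^\lambda(x)r^t$, and for $\lambda=0$ by the Chebyshev polynomial of the first kind $C_t^0(x)=\cos(t\arccos x)$. Then $Q_{n,t}(x)=A_{n,t}C_t^{(n-2)/2}(x)$, where the constant $A_{n,t}$ is chosen so that $Q_{n,t}(1)=\binom{n+t-1}{t}-\binom{n+t-3}{t-2}$. Put $c_{n,t}=-\min_{-1\le x\le1}Q_{n,t}(x)$, which is positive, and $b_{n,t}=1+\frac1{c_{n,t}}\left\{\binom{n+t-1}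{t}-\binom{n+t-3}{t-2}\right\}$.
   Formalization: For n = 2 the literal equality I(X) = {±α} is false (t = 4, two unit vectors at angle π/4, I(X) = {√2/2}), so there it is proved that I(X) is nonempty and contained in {α, −α}; for n ≥ 3 the equality I(X) = {α, −α} is proved. *)

theory Defs
  imports "HOL-Analysis.Analysis"
begin

definition homogeneous_polynomial :: "nat \<Rightarrow> (real ^ 'n \<Rightarrow> real) \<Rightarrow> bool" where
  "homogeneous_polynomial t f \<longleftrightarrow>
     (\<exists>c :: ('n \<Rightarrow> nat) \<Rightarrow> real.
        f = (\<lambda>x. \<Sum>m\<in>{m. (\<Sum>i\<in>UNIV. m i) = t}. c m * (\<Prod>i\<in>UNIV. (x $ i) ^ m i)))"

definition partial :: "'n \<Rightarrow> (real ^ 'n \<Rightarrow> real) \<Rightarrow> real ^ 'n \<Rightarrow> real" where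
  "partial i f x = deriv (\<lambda>s. f (x + s *\<^sub>R axis i 1)) 0"

definition laplacian :: "(real ^ 'n \<Rightarrow> real) \<Rightarrow> real ^ 'n \<Rightarrow> real" where
  "laplacian f x = (\<Sum>i\<in>UNIV. partial i (partial i f) x)"

definition Harm :: "nat \<Rightarrow> (real ^ 'n \<Rightarrow> real) set" where
  "Harm t = {f. homogeneous_polynomial t f \<and> (\<forall>x. laplacian f x = 0)}"

definition harmonic_index_design :: "nat \<Rightarrow> (real ^ 'n) set \<Rightarrow> bool" where
  "harmonic_index_design t X \<longleftrightarrow>
     finite X \<and> X \<noteq> {} \<and> X \<subseteq> sphere 0 1 \<and> (\<forall>f\<in>Harm t. (\<Sum>x\<in>X. f x) = 0)"

definition inner_products :: "(real ^ 'n) set \<Rightarrow> real set" where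
  "inner_products X = {x \<bullet> y | x y. x \<in> X \<and> y \<in> X \<and> x \<noteq> y}"

text \<open>An assertion written \<open>I(X) = {\<plusminus>\<alpha>}\<close> cannot mean equality with \<open>{\<alpha>, - \<alpha>}\<close> on
  the circle: two unit vectors at angle \<open>pi / 4\<close> form a design of harmonic index \<open>4\<close> whose
  cardinality equals the bound \<open>b_const 2 4 = 2\<close> below, and their only inner product is
  \<open>sqrt 2 / 2\<close>.  On the circle it is therefore rendered as
  \<open>inner_products X \<noteq> {}\<close> and \<open>inner_products X \<subseteq> {\<alpha>, - \<alpha>}\<close>; in dimension at least \<open>3\<close> it is
  rendered as the equality.\<close>

text \<open>For nonzero \<open>a\<close> the value is the coefficient of \<open>r ^ t\<close> in
  \<open>(1 - 2 * x * r + r\<^sup>2) powr (- a)\<close>, read as the binomial series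
  \<open>(1 + u) powr (- a)\<close> with \<open>u = r\<^sup>2 - 2 * x * r\<close> substituted.
  For \<open>a = 0\<close> the formula is meaningful for \<open>- 1 \<le> x \<le> 1\<close> only, where it is the
  Chebyshev polynomial of the first kind.\<close>

definition gegenbauer :: "real \<Rightarrow> nat \<Rightarrow> real \<Rightarrow> real" where
  "gegenbauer a t x =
     (if a = 0 then cos (real t * arccos x)
      else fps_nth (fps_compose (fps_binomial (- a)) (fps_X ^ 2 - fps_const (2 * x) * fps_X)) t)"

text \<open>The second binomial coefficient is \<open>0\<close> for \<open>t < 2\<close>, since its lower index is then negative;
  the case distinction keeps truncated subtraction from changing this.\<close>

definition harm_dim :: "nat \<Rightarrow> nat \<Rightarrow> real" where
  "harm_dim n t = real ((n + t - 1) choose t) -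
     (if t < 2 then 0 else real ((n + t - 3) choose (t - 2)))"

definition A_const :: "nat \<Rightarrow> nat \<Rightarrow> real" where
  "A_const n t = harm_dim n t / gegenbauer ((real n - 2) / 2) t 1"

definition Q_poly :: "nat \<Rightarrow> nat \<Rightarrow> real \<Rightarrow> real" where
  "Q_poly n t x = A_const n t * gegenbauer ((real n - 2) / 2) t x"

text \<open>The least element below exists for \<open>n \<ge> 2\<close>, as \<open>Q_poly n t\<close> is continuous on \<open>{-1..1}\<close>.\<close>

definition c_const :: "nat \<Rightarrow> nat \<Rightarrow> real" where
  "c_const n t = - (LEAST v. v \<in> Q_poly n t ` {-1..1})"

definition b_const :: "nat \<Rightarrow> nat \<Rightarrow> real" where
  "b_const n t = 1 + (1 / c_const n t) * harm_dim n t"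

end

(*
For n = 2 the bound is 2 and X has a single inner product.  Let n >= 3.  Summing the zonal harmonic
|x|^t Q(<x,y>/|x|) over X, for y in X, gives Q(1) + sum_{x ~= y} Q(<x,y>) = 0; since Q >= -c, equality
|X| = 1 + Q(1)/c forces Q(<x,y>) = -c for all x ~= y.  By the Gegenbauer equation, Sonine's function
f^2 + (1 - x^2) f'^2 / N is nondecreasing on [0,1], so the minimum of the even polynomial Q is attained
at a single pair +-alpha.

It remains to see that both signs occur, that is, that the inner products are not all equal to some
b ~= 0.  For t = 2 the minimum is at 0.  For t >= 4, the harmonic polynomials Re, Im of <x, u + iv>^t
with |u| = |v|, <u,v> = 0 exclude this: they show that X spans R^n, and then, with u + iv a complex
combination of three or four points of X, they give a nonvanishing power sum unless b = 0.
*)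
theory Submission
  imports Defs
begin

section \<open>Homogeneous polynomials and harmonic test functions\<close>

definition multi_indices :: "nat \<Rightarrow> ('n::finite \<Rightarrow> nat) set" where
  "multi_indices t = {m. (\<Sum>i\<in>UNIV. m i) = t}"

lemma finite_multi_indices: "finite (multi_indices t :: ('n::finite \<Rightarrow> nat) set)"
proof (rule finite_subset)
  show "multi_indices t \<subseteq> (PiE UNIV (\<lambda>_. {..t}) :: ('n \<Rightarrow> nat) set)"
    by (auto simp: multi_indices_def member_le_sum)
  show "finite (PiE UNIV (\<lambda>_. {..t}) :: ('n \<Rightarrow> nat) set)"
    by (rule finite_PiE) auto
qed

lemma homogeneous_polynomial_iff:
  "homogeneous_polynomial t f \<longleftrightarrow>
     (\<exists>c. f = (\<lambda>x. \<Sum>m\<in>multi_indices t. c m * (\<Prod>i\<in>UNIV. (x $ i) ^ m i)))"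
  by (simp add: homogeneous_polynomial_def multi_indices_def)

lemma homogeneous_polynomial_const: "homogeneous_polynomial 0 (\<lambda>x :: real ^ 'n. a)"
proof -
  have "multi_indices 0 = {\<lambda>_ :: 'n. 0}"
    by (auto simp: multi_indices_def)
  then show ?thesis
    by (auto simp: homogeneous_polynomial_iff intro!: exI[of _ "\<lambda>_. a"])
qed

lemma homogeneous_polynomial_zero: "homogeneous_polynomial t (\<lambda>x. 0)"
  by (auto simp: homogeneous_polynomial_iff intro!: exI[of _ "\<lambda>_. 0"])

lemma homogeneous_polynomial_add:
  assumes "homogeneous_polynomial t f" "homogeneous_polynomial t g"
  shows "homogeneous_polynomial t (\<lambda>x. f x + g x)"
proof -
  obtain c d where "f = (\<lambda>x. \<Sum>m\<in>multi_indices t. c m * (\<Prod>i\<in>UNIV. (x $ i) ^ m i))"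
    "g = (\<lambda>x. \<Sum>m\<in>multi_indices t. d m * (\<Prod>i\<in>UNIV. (x $ i) ^ m i))"
    using assms by (auto simp: homogeneous_polynomial_iff)
  then show ?thesis
    unfolding homogeneous_polynomial_iff
    by (intro exI[of _ "\<lambda>m. c m + d m"]) (simp add: sum.distrib algebra_simps)
qed

lemma homogeneous_polynomial_sum:
  assumes "\<And>k. k \<in> K \<Longrightarrow> homogeneous_polynomial t (f k)"
  shows "homogeneous_polynomial t (\<lambda>x. \<Sum>k\<in>K. f k x)"
  using assms
  by (induction K rule: infinite_finite_induct)
    (auto intro: homogeneous_polynomial_zero homogeneous_polynomial_add)

lemma homogeneous_polynomial_scale:
  assumes "homogeneous_polynomial t f"
  shows "homogeneous_polynomial t (\<lambda>x. a * f x)"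
proof -
  obtain c where "f = (\<lambda>x. \<Sum>m\<in>multi_indices t. c m * (\<Prod>i\<in>UNIV. (x $ i) ^ m i))"
    using assms by (auto simp: homogeneous_polynomial_iff)
  then show ?thesis
    unfolding homogeneous_polynomial_iff
    by (intro exI[of _ "\<lambda>m. a * c m"]) (simp add: sum_distrib_left algebra_simps)
qed

text \<open>Multiplying by a coordinate raises one exponent. The coefficients are therefore
  transported along the bijection \<open>up\<close> from \<open>multi_indices t\<close> onto the
  members of \<open>multi_indices (Suc t)\<close> whose exponent at \<open>i\<close> is nonzero; all
  other coefficients are set to 0.\<close>

lemma homogeneous_polynomial_times_coord:
  fixes f :: "real ^ 'n \<Rightarrow> real"
  assumes "homogeneous_polynomial t f"
  shows "homogeneous_polynomial (Suc t) (\<lambda>x. x $ i * f x)"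
proof -
  let ?mon = "\<lambda>m (x :: real ^ 'n). \<Prod>i\<in>UNIV. (x $ i) ^ m i"
  obtain c where c: "f = (\<lambda>x. \<Sum>m\<in>multi_indices t. c m * ?mon m x)"
    using assms by (auto simp: homogeneous_polynomial_iff)
  define up where "up = (\<lambda>m :: 'n \<Rightarrow> nat. m(i := Suc (m i)))"
  define down where "down = (\<lambda>m :: 'n \<Rightarrow> nat. m(i := m i - 1))"
  define d where "d = (\<lambda>m. if m i = 0 then 0 else c (down m))"
  have split: "(\<Sum>j\<in>UNIV. m j) = m i + (\<Sum>j\<in>UNIV - {i}. m j)" for m :: "'n \<Rightarrow> nat"
    by (simp add: sum.remove)
  have psplit: "?mon m x = x $ i ^ m i * (\<Prod>j\<in>UNIV - {i}. (x $ j) ^ m j)" for m x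
    by (simp add: prod.remove)
  have up_in: "up m \<in> multi_indices (Suc t)" if "m \<in> multi_indices t" for m
    using that split[of m] split[of "up m"] by (simp add: multi_indices_def up_def)
  have down_in: "down m \<in> multi_indices t" if "m \<in> multi_indices (Suc t)" "m i \<noteq> 0" for m
    using that split[of m] split[of "down m"] by (simp add: multi_indices_def down_def)
  have mon_up: "?mon (up m) x = x $ i * ?mon m x" for m x
    unfolding psplit by (simp add: up_def)
  have "x $ i * f x = (\<Sum>m\<in>multi_indices (Suc t). d m * ?mon m x)" for x
  proof -
    have "(\<Sum>m\<in>multi_indices (Suc t). d m * ?mon m x)
        = (\<Sum>m\<in>{m \<in> multi_indices (Suc t). m i \<noteq> 0}. d m * ?mon m x)"
      by (rule sum.mono_neutral_right) (auto simp: finite_multi_indices d_def)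
    also have "\<dots> = (\<Sum>m\<in>multi_indices t. c m * (x $ i * ?mon m x))"
      proof (rule sum.reindex_bij_witness[of _ up down])
      fix m assume m: "m \<in> {m \<in> multi_indices (Suc t). m i \<noteq> 0}"
      then show ud: "up (down m) = m" by (simp add: up_def down_def)
      show "down m \<in> multi_indices t" using m by (simp add: down_in)
      show "c (down m) * (x $ i * ?mon (down m) x) = d m * ?mon m x"
        using m mon_up[where m = "down m" and x = x] ud by (simp add: d_def)
    qed (auto simp: up_in, auto simp: up_def down_def)
    finally show ?thesis
      by (simp add: c sum_distrib_left algebra_simps)
  qed
  then show ?thesis
    unfolding homogeneous_polynomial_iff by auto
qed

lemma homogeneous_polynomial_times_inner:
  fixes f :: "real ^ 'n \<Rightarrow> real"
  assumes "homogeneous_polynomial t f"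
  shows "homogeneous_polynomial (Suc t) (\<lambda>x. (x \<bullet> y) * f x)"
proof -
  have "homogeneous_polynomial (Suc t) (\<lambda>x. \<Sum>i\<in>UNIV. y $ i * (x $ i * f x))"
    by (intro homogeneous_polynomial_sum homogeneous_polynomial_scale
        homogeneous_polynomial_times_coord assms)
  then show ?thesis
    by (simp add: inner_vec_def sum_distrib_right mult.assoc mult.left_commute)
qed

lemma homogeneous_polynomial_times_norm_square:
  fixes f :: "real ^ 'n \<Rightarrow> real"
  assumes "homogeneous_polynomial t f"
  shows "homogeneous_polynomial (t + 2) (\<lambda>x. (x \<bullet> x) * f x)"
proof -
  have "homogeneous_polynomial (Suc (Suc t)) (\<lambda>x. \<Sum>i\<in>UNIV. x $ i * (x $ i * f x))"
    by (intro homogeneous_polynomial_sum homogeneous_polynomial_times_coord assms)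
  then show ?thesis
    by (simp add: inner_vec_def sum_distrib_right mult.assoc)
qed

lemma homogeneous_polynomial_zonal:
  "homogeneous_polynomial (p + 2 * k) (\<lambda>x :: real ^ 'n. (x \<bullet> y) ^ p * (x \<bullet> x) ^ k)"
proof (induction k)
  case 0
  show ?case
  proof (induction p)
    case 0
    show ?case using homogeneous_polynomial_const[of 1] by simp
  next
    case (Suc p)
    then show ?case using homogeneous_polynomial_times_inner[of p] by (fastforce simp: mult.assoc)
  qed
next
  case (Suc k)
  from homogeneous_polynomial_times_norm_square[OF this] show ?case
    by (simp add: algebra_simps)
qed

section \<open>Partial derivatives and powers of isotropic linear forms\<close>

lemma partialI:
  assumes "((\<lambda>s. f (x + s *\<^sub>R axis i 1)) has_real_derivative D) (at 0)"
  shows "partial i f x = D"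
  using assms by (simp add: partial_def DERIV_imp_deriv)

text \<open>The derivative has the same shape with another complex factor, so the rule can be
  applied twice. The truncated exponent at \<open>k = 0\<close> is harmless because the factor
  \<open>of_nat k\<close> vanishes.\<close>

lemma DERIV_Re_power:
  fixes c z w :: complex
  shows "((\<lambda>s. Re (c * (z + of_real s * w) ^ k)) has_real_derivative
           Re (c * of_nat k * w * z ^ (k - 1))) (at 0)"
proof -
  have "((\<lambda>s. c * (z + s * w) ^ k) has_field_derivative c * (of_nat k * w * z ^ (k - 1))) (at 0)"
    by (auto intro!: derivative_eq_intros)
  then have "((\<lambda>s. c * (z + s * w) ^ k) has_field_derivative c * (of_nat k * w * z ^ (k - 1)))
      (at (of_real 0))"
    by simp
  from has_field_derivative_Re[OF has_vector_derivative_real_field[OF this]]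
  show ?thesis
    by (simp add: mult.assoc)
qed

text \<open>With w = u + iv and L(x) = <x, w>, the Laplacian of L^t is t (t - 1) L^(t - 2) times the
  sum of the squares w_i^2, and the hypotheses make that sum 0. The free factor \<open>c\<close>
  covers real and imaginary parts at once.\<close>

lemma isotropic_power_in_Harm:
  fixes u v :: "real ^ 'n"
  assumes "u \<bullet> u = v \<bullet> v" "u \<bullet> v = 0"
  shows "(\<lambda>x. Re (c * Complex (x \<bullet> u) (x \<bullet> v) ^ t)) \<in> Harm t"
proof -
  define w where "w = (\<lambda>i. Complex (u $ i) (v $ i))"
  define L where "L = (\<lambda>x. Complex (x \<bullet> u) (x \<bullet> v))"
  have L: "L x = (\<Sum>i\<in>UNIV. of_real (x $ i) * w i)" for x
    by (simp add: L_def w_def complex_eq_iff inner_vec_def)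
  have shift: "L (x + s *\<^sub>R axis i 1) = L x + of_real s * w i" for x s i
    by (simp add: L_def w_def complex_eq_iff inner_add_left inner_axis')
  have "homogeneous_polynomial t (\<lambda>x. Re (c * L x ^ t))"
  \<comment> \<open>Splitting off one factor L, expanded in coordinates, replaces \<open>c\<close>
    by \<open>c * w i\<close>; hence the generalisation over \<open>c\<close>.\<close>
  proof (induction t arbitrary: c)
    case 0
    show ?case by (simp add: homogeneous_polynomial_const)
  next
    case (Suc t)
    have "homogeneous_polynomial (Suc t) (\<lambda>x. \<Sum>i\<in>UNIV. x $ i * Re (c * w i * L x ^ t))"
      by (intro homogeneous_polynomial_sum homogeneous_polynomial_times_coord Suc.IH)
    moreover have "(\<Sum>i\<in>UNIV. x $ i * Re (c * w i * L x ^ t)) = Re (c * L x ^ Suc t)" for x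
    proof -
      have "(\<Sum>i\<in>UNIV. x $ i * Re (c * w i * L x ^ t))
          = Re (\<Sum>i\<in>UNIV. of_real (x $ i) * (c * w i * L x ^ t))"
        by simp
      also have "(\<Sum>i\<in>UNIV. of_real (x $ i) * (c * w i * L x ^ t)) = c * L x * L x ^ t"
        by (subst (2) L) (simp add: sum_distrib_left sum_distrib_right mult_ac)
      finally show ?thesis by (simp add: mult_ac)
    qed
    ultimately show ?case by simp
  qed
  moreover have "laplacian (\<lambda>x. Re (c * L x ^ t)) x = 0" for x
  proof -
    have p: "partial i (\<lambda>x. Re (b * L x ^ k)) = (\<lambda>x. Re (b * of_nat k * w i * L x ^ (k - 1)))"
      for b i k
      by (rule ext, rule partialI, unfold shift, rule DERIV_Re_power)
    have "laplacian (\<lambda>x. Re (c * L x ^ t)) x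
        = (\<Sum>i\<in>UNIV. Re (c * of_nat t * w i * of_nat (t - 1) * w i * L x ^ (t - 1 - 1)))"
      by (simp only: laplacian_def p)
    also have "\<dots> = Re (\<Sum>i\<in>UNIV. c * of_nat t * w i * of_nat (t - 1) * w i * L x ^ (t - 1 - 1))"
      by (rule Re_sum[symmetric])
    also have "(\<Sum>i\<in>UNIV. c * of_nat t * w i * of_nat (t - 1) * w i * L x ^ (t - 1 - 1))
        = c * of_nat t * of_nat (t - 1) * L x ^ (t - 1 - 1) * (\<Sum>i\<in>UNIV. w i * w i)"
      by (subst sum_distrib_left) (simp only: mult_ac)
    also have "(\<Sum>i\<in>UNIV. w i * w i) = 0"
    proof -
      have "(\<Sum>i\<in>UNIV. w i * w i) = Complex (u \<bullet> u - v \<bullet> v) (2 * (u \<bullet> v))"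
        by (simp add: w_def complex_eq_iff inner_vec_def sum_subtractf sum_distrib_left mult_ac)
      with assms show ?thesis by (simp add: Complex_eq_0)
    qed
    finally show ?thesis by simp
  qed
  ultimately show ?thesis
    by (simp add: Harm_def L_def)
qed

lemma design_isotropic_power_sum:
  fixes X :: "(real ^ 'n) set"
  assumes "harmonic_index_design t X" "u \<bullet> u = v \<bullet> v" "u \<bullet> v = 0"
  shows "(\<Sum>x\<in>X. Complex (x \<bullet> u) (x \<bullet> v) ^ t) = 0"
proof -
  have "(\<Sum>x\<in>X. Re (c * Complex (x \<bullet> u) (x \<bullet> v) ^ t)) = 0" for c
    using assms isotropic_power_in_Harm[of u v c t] by (simp add: harmonic_index_design_def)
  then have "Re (c * (\<Sum>x\<in>X. Complex (x \<bullet> u) (x \<bullet> v) ^ t)) = 0" for c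
    by (simp only: sum_distrib_left Re_sum)
  from this[of 1] this[of "- \<i>"] show ?thesis
    by (simp add: complex_eq_iff)
qed

text \<open>At degree 0 every summand is \<open>0 ^ 0 = 1\<close>, so the power sum counts the
  points of \<open>X\<close>.\<close>

lemma design_index_pos:
  assumes "harmonic_index_design t X"
  shows "t > 0"
proof (rule ccontr)
  assume "\<not> t > 0"
  with design_isotropic_power_sum[OF assms, of 0 0] have "card X = 0"
    by simp
  with assms show False
    by (simp add: harmonic_index_design_def)
qed

section \<open>Equiangular designs\<close>

lemma design_norm:
  assumes "harmonic_index_design t X" "x \<in> X"
  shows "x \<bullet> x = 1"
  using assms by (auto simp: harmonic_index_design_def norm_eq_1[symmetric] dist_norm)

text \<open>A unit vector \<open>v\<close> orthogonal to \<open>X\<close>, together with a point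
  \<open>x0\<close> of \<open>X\<close>, gives an isotropic vector x0 + iv. On \<open>X\<close> its
  linear form is the real number <x, x0>, and a sum of even powers containing <x0, x0>^t = 1 cannot
  vanish.\<close>

lemma design_dim:
  fixes X :: "(real ^ 'n) set"
  assumes "harmonic_index_design t X" "even t"
  shows "CARD('n) \<le> dim X"
proof (rule ccontr)
  assume "\<not> CARD('n) \<le> dim X"
  then obtain y where y: "y \<noteq> 0" "\<And>z. z \<in> span X \<Longrightarrow> orthogonal y z"
    using orthogonal_to_subspace_exists[of X] by auto
  obtain x0 where x0: "x0 \<in> X"
    using assms by (auto simp: harmonic_index_design_def)
  define v where "v = y /\<^sub>R norm y"
  have "norm v = 1"
    using y(1) by (simp add: v_def)
  then have v1: "v \<bullet> v = 1"
    by (simp add: norm_eq_1)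
  have v: "x \<bullet> v = 0" if "x \<in> X" for x
    using y(2)[OF span_base[OF that]] by (simp add: v_def orthogonal_def inner_commute)
  have "(\<Sum>x\<in>X. Complex (x \<bullet> x0) (x \<bullet> v) ^ t) = 0"
    by (rule design_isotropic_power_sum[OF assms(1)]) (use v v1 x0 design_norm[OF assms(1)] in auto)
  also have "(\<Sum>x\<in>X. Complex (x \<bullet> x0) (x \<bullet> v) ^ t) = complex_of_real (\<Sum>x\<in>X. (x \<bullet> x0) ^ t)"
    by (simp add: v complex_of_real_def[symmetric])
  finally have "(\<Sum>x\<in>X. (x \<bullet> x0) ^ t) = 0"
    by (simp only: of_real_eq_0_iff)
  moreover have "(x0 \<bullet> x0) ^ t \<le> (\<Sum>x\<in>X. (x \<bullet> x0) ^ t)"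
    by (rule member_le_sum[OF x0])
      (use assms in \<open>auto simp: harmonic_index_design_def zero_le_even_power\<close>)
  ultimately show False
    using design_norm[OF assms(1) x0] by simp
qed

text \<open>The isotropic vector \<open>u + \<i> v\<close> of \<open>design_isotropic_power_sum\<close> is taken to be
  \<open>\<Sum>x\<in>X. a x *\<^sub>R x\<close>, with complex coefficients; the hypothesis on \<open>a\<close> is its isotropy.\<close>

lemma equiangular_design_power_sum:
  fixes X :: "(real ^ 'n) set" and a :: "real ^ 'n \<Rightarrow> complex"
  assumes design: "harmonic_index_design t X"
    and equi: "\<And>x y. x \<in> X \<Longrightarrow> y \<in> X \<Longrightarrow> x \<noteq> y \<Longrightarrow> x \<bullet> y = b"
    and iso: "(1 - of_real b) * (\<Sum>x\<in>X. (a x)\<^sup>2) + of_real b * (\<Sum>x\<in>X. a x)\<^sup>2 = 0"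
  shows "(\<Sum>y\<in>X. ((1 - of_real b) * a y + of_real b * (\<Sum>x\<in>X. a x)) ^ t) = 0"
proof -
  have fin: "finite X"
    using design by (simp add: harmonic_index_design_def)
  define comb where "comb = (\<lambda>c :: real ^ 'n \<Rightarrow> real. \<Sum>x\<in>X. c x *\<^sub>R x)"
  define u where "u = comb (\<lambda>x. Re (a x))"
  define v where "v = comb (\<lambda>x. Im (a x))"
  define S where "S = (\<Sum>x\<in>X. a x)"
  \<comment> \<open>The Gram matrix of \<open>X\<close> is (1 - b) times the identity plus b times
    the all-ones matrix.\<close>
  have inner_comb: "y \<bullet> comb c = (1 - b) * c y + b * (\<Sum>x\<in>X. c x)" if "y \<in> X" for y c
  proof -
    have "y \<bullet> comb c = c y * (y \<bullet> y) + (\<Sum>x\<in>X-{y}. c x * (y \<bullet> x))"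
      using fin that by (simp add: comb_def inner_sum_right inner_add_right sum.remove)
    also have "(\<Sum>x\<in>X-{y}. c x * (y \<bullet> x)) = b * (\<Sum>x\<in>X-{y}. c x)"
      unfolding sum_distrib_left
    proof (intro sum.cong refl)
      fix x assume "x \<in> X - {y}"
      then have "y \<bullet> x = b" using equi[OF that, of x] by auto
      then show "c x * (y \<bullet> x) = b * c x" by simp
    qed
    also have "(\<Sum>x\<in>X-{y}. c x) = (\<Sum>x\<in>X. c x) - c y"
      using fin that by (simp add: sum.remove[of X y])
    finally show ?thesis
      using design_norm[OF design that] by (simp add: algebra_simps)
  qed
  have z: "Complex (y \<bullet> u) (y \<bullet> v) = (1 - of_real b) * a y + of_real b * S" if "y \<in> X" for y
    using that by (simp add: u_def v_def inner_comb S_def complex_eq_iff)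
  have u_inner: "u \<bullet> w = (\<Sum>x\<in>X. Re (a x) * (x \<bullet> w))"
    and v_inner: "v \<bullet> w = (\<Sum>x\<in>X. Im (a x) * (x \<bullet> w))" for w
    by (simp_all add: u_def v_def comb_def inner_sum_left)
  have "(\<Sum>x\<in>X. a x * Complex (x \<bullet> u) (x \<bullet> v)) = (\<Sum>x\<in>X. a x * ((1 - of_real b) * a x + of_real b * S))"
    by (intro sum.cong refl) (simp add: z)
  also have "\<dots> = (\<Sum>x\<in>X. (1 - of_real b) * (a x)\<^sup>2 + of_real b * S * a x)"
    by (intro sum.cong refl) (simp add: algebra_simps power2_eq_square)
  also have "\<dots> = (1 - of_real b) * (\<Sum>x\<in>X. (a x)\<^sup>2) + of_real b * S * S"
    unfolding S_def by (simp only: sum.distrib sum_distrib_left)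
  also have "\<dots> = 0"
    using iso by (simp add: S_def power2_eq_square mult.assoc)
  finally have "(\<Sum>x\<in>X. a x * Complex (x \<bullet> u) (x \<bullet> v)) = 0" .
  \<comment> \<open>The same sum is the bilinear square of u + iv, so its vanishing is exactly the
    isotropy required.\<close>
  moreover have "(\<Sum>x\<in>X. a x * Complex (x \<bullet> u) (x \<bullet> v)) = Complex (u \<bullet> u - v \<bullet> v) (u \<bullet> v + v \<bullet> u)"
    by (simp add: u_inner v_inner complex_eq_iff sum_subtractf sum.distrib)
  ultimately have "u \<bullet> u = v \<bullet> v" "u \<bullet> v = 0"
    by (auto simp: complex_eq_iff inner_commute)
  from design_isotropic_power_sum[OF design this] show ?thesis
    by (simp add: z S_def cong: sum.cong)
qed

text \<open>Coefficients with zero sum and zero sum of squares are isotropic for every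
  \<open>b\<close>. After division by (1 - b)^t, the design condition says that the sum of their
  \<open>t\<close>-th powers is 0; four suitable coefficients violate this for every even t >=
  4.\<close>

lemma equiangular_design_card_less_4:
  fixes X :: "(real ^ 'n) set"
  assumes design: "harmonic_index_design t X" and "even t" "t \<ge> 4" and "b < 1"
    and equi: "\<And>x y. x \<in> X \<Longrightarrow> y \<in> X \<Longrightarrow> x \<noteq> y \<Longrightarrow> x \<bullet> y = b"
  shows "card X < 4"
proof (rule ccontr)
  assume "\<not> card X < 4"
  then have "Suc (Suc (Suc (Suc 0))) \<le> card X" by simp
  then obtain x1 x2 x3 x4 B where X: "X = insert x1 (insert x2 (insert x3 (insert x4 B)))"
    and dist: "x1 \<notin> {x2, x3, x4}" "x2 \<notin> {x3, x4}" "x3 \<noteq> x4"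
    by (elim card_le_Suc_iff[THEN iffD1, elim_format] exE conjE) auto
  have fin: "finite X"
    using design by (simp add: harmonic_index_design_def)
  \<comment> \<open>\<open>1, w, cnj w, - 1 / 2\<close> have zero sum and zero sum of squares, while \<open>1\<close> dominates
    the \<open>t\<close>-th powers for \<open>t \<ge> 6\<close>.\<close>
  define w where "w = Complex (- (1 / 4)) (sqrt 11 / 4)"
  define a where "a = (\<lambda>_. 0 :: complex)(x1 := 1, x2 := w, x3 := cnj w, x4 := - 1 / 2)"
  have sum_a: "(\<Sum>x\<in>X. F (a x)) = F 1 + F w + F (cnj w) + F (- 1 / 2)"
    if "F 0 = 0" for F :: "complex \<Rightarrow> complex"
  proof -
    have "(\<Sum>x\<in>X. F (a x)) = (\<Sum>x\<in>{x1, x2, x3, x4}. F (a x))"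
      by (rule sum.mono_neutral_right) (use fin X that in \<open>auto simp: a_def\<close>)
    also have "\<dots> = F 1 + F w + F (cnj w) + F (- 1 / 2)"
      using dist by (auto simp: a_def)
    finally show ?thesis .
  qed
  define W where "W = Complex (- (5 / 8)) (- (sqrt 11 / 8))"
  have W: "w\<^sup>2 = W" "(cnj w)\<^sup>2 = cnj W"
    by (auto simp: w_def W_def complex_eq_iff power2_eq_square)
  have S1: "(\<Sum>x\<in>X. a x) = 0"
    using sum_a[of "\<lambda>x. x"] by (simp add: w_def complex_eq_iff)
  have S2: "(\<Sum>x\<in>X. (a x)\<^sup>2) = 0"
    using sum_a[of "\<lambda>x. x\<^sup>2"] unfolding W by (simp add: W_def complex_eq_iff power2_eq_square)
  obtain k where k: "t = 2 * k" "k \<ge> 2"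
    using \<open>even t\<close> \<open>t \<ge> 4\<close> by (auto elim!: evenE)
  have "(\<Sum>y\<in>X. ((1 - of_real b) * a y + of_real b * (\<Sum>x\<in>X. a x)) ^ t) = 0"
    by (rule equiangular_design_power_sum[OF design equi]) (auto simp: S1 S2)
  then have "(1 - of_real b) ^ t * (\<Sum>y\<in>X. a y ^ t) = 0"
    by (simp add: S1 power_mult_distrib sum_distrib_left)
  then have "(\<Sum>y\<in>X. a y ^ t) = 0"
    using \<open>b < 1\<close> by (auto simp: complex_eq_iff)
  then have "1 + W ^ k + cnj W ^ k + ((- 1 / 2)\<^sup>2) ^ k = 0"
    using sum_a[of "\<lambda>x. x ^ t"] k by (simp add: power_mult W)
  moreover have "((- 1 / 2)\<^sup>2) ^ k = complex_of_real ((1 / 4) ^ k)"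
    by (simp add: power2_eq_square power_divide)
  ultimately have "Re (1 + W ^ k + cnj W ^ k + complex_of_real ((1 / 4) ^ k)) = 0"
    by simp
  moreover have "Re (cnj W ^ k) = Re (W ^ k)"
    by (simp flip: complex_cnj_power)
  ultimately have "1 + 2 * Re (W ^ k) + (1 / 4) ^ k = 0"
    by (simp del: complex_cnj_power)
  moreover have "Re (W ^ k) > - 1 / 2"
  \<comment> \<open>The estimate |W|^k = (3/4)^k falls below 1/2 only from k = 3 on, so k = 2 is
    computed directly.\<close>
  proof (cases "k = 2")
    case True
    then show ?thesis by (simp add: W_def power2_eq_square)
  next
    case False
    have "cmod W = 3 / 4"
      by (simp add: W_def cmod_def power2_eq_square real_sqrt_divide real_sqrt_unique)
    then have "\<bar>Re (W ^ k)\<bar> \<le> (3 / 4) ^ k"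
      by (metis abs_Re_le_cmod norm_power)
    also have "\<dots> \<le> (3 / 4 :: real) ^ 3"
      using False k by (intro power_decreasing) auto
    also have "\<dots> < 1 / 2"
      by (simp add: power3_eq_cube)
    finally show ?thesis by simp
  qed
  moreover have "(0 :: real) < (1 / 4) ^ k"
    by simp
  ultimately show False by linarith
qed

text \<open>Two isotropic vectors in the span of the three points give the equations
  \<open>A\<close> and \<open>B\<close>. Inserting \<open>B\<close> into \<open>A\<close> leaves (1
  + 2b)^k = 1 with a positive base.\<close>

lemma equiangular_design_card_3:
  fixes X :: "(real ^ 'n) set"
  assumes design: "harmonic_index_design t X" and "even t" "t > 0" and b: "b < 1" "1 + 2 * b > 0"
    and equi: "\<And>x y. x \<in> X \<Longrightarrow> y \<in> X \<Longrightarrow> x \<noteq> y \<Longrightarrow> x \<bullet> y = b"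
    and "card X = 3"
  shows "b = 0"
proof -
  obtain x1 x2 x3 where X: "X = {x1, x2, x3}" and dist: "x1 \<noteq> x2" "x1 \<noteq> x3" "x2 \<noteq> x3"
    using \<open>card X = 3\<close> by (auto simp: card_3_iff)
  obtain k where k: "t = 2 * k" "k > 0"
    using \<open>even t\<close> \<open>t > 0\<close> by (auto elim!: evenE)
  let ?b = "complex_of_real b"
  have test: "((1 - ?b) * p + ?b * (p + q + r)) ^ t + ((1 - ?b) * q + ?b * (p + q + r)) ^ t
      + ((1 - ?b) * r + ?b * (p + q + r)) ^ t = 0"
    if "(1 - ?b) * (p\<^sup>2 + q\<^sup>2 + r\<^sup>2) + ?b * (p + q + r)\<^sup>2 = 0" for p q r
    using equiangular_design_power_sum[OF design equi, of "(\<lambda>_. 0)(x1 := p, x2 := q, x3 := r)"] that dist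
    by (simp add: X add.assoc)
  have b1: "1 + b > 0" "1 - b > 0" using b by auto
  \<comment> \<open>The coefficient vectors \<open>(1 + b, - b + d, - b - d)\<close> in step \<open>A\<close> and \<open>(c, 1, 1)\<close> in step
    \<open>B\<close> give the inner products \<open>(z, d', - d')\<close> and \<open>(\<i> r, y, y)\<close> with \<open>z, r\<close> real and
    \<open>d'\<close> imaginary.\<close>
  define D where "D = (1 + b) * (1 + 2 * b) / 2"
  have D: "D > 0" using b b1 by (simp add: D_def)
  have A: "(1 + 2 * b) ^ k = 2 * ((1 + b) / 2) ^ k"
  proof -
    \<comment> \<open>For the coefficients of step \<open>A\<close>, isotropy reduces to 2 d^2 = -(1
      + b)(1 + 2b), that is, d^2 = -D.\<close>
    define d where "d = \<i> * complex_of_real (sqrt D)"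
    have d: "d\<^sup>2 = complex_of_real (- D)"
      using D by (simp add: d_def power_mult_distrib flip: of_real_power)
    have "((1 - ?b) * (1 + ?b) + ?b * (1 + ?b + (- ?b + d) + (- ?b - d))) ^ t
       + ((1 - ?b) * (- ?b + d) + ?b * (1 + ?b + (- ?b + d) + (- ?b - d))) ^ t
      + ((1 - ?b) * (- ?b - d) + ?b * (1 + ?b + (- ?b + d) + (- ?b - d))) ^ t = 0"
    proof (rule test)
      have "(1 - ?b) * ((1 + ?b)\<^sup>2 + (- ?b + d)\<^sup>2 + (- ?b - d)\<^sup>2) + ?b * (1 + ?b + (- ?b + d) + (- ?b - d))\<^sup>2
          = (1 - ?b) * ((1 + ?b)\<^sup>2 + 2 * ?b\<^sup>2 + 2 * d\<^sup>2 + ?b * (1 - ?b))"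
        by (simp add: algebra_simps power2_eq_square)
      also have "2 * d\<^sup>2 = - ((1 + ?b) * (1 + 2 * ?b))"
        by (simp add: d D_def)
      also have "(1 - ?b) * ((1 + ?b)\<^sup>2 + 2 * ?b\<^sup>2 + - ((1 + ?b) * (1 + 2 * ?b)) + ?b * (1 - ?b)) = 0"
        by (simp add: algebra_simps power2_eq_square)
      finally show "(1 - ?b) * ((1 + ?b)\<^sup>2 + (- ?b + d)\<^sup>2 + (- ?b - d)\<^sup>2) + ?b * (1 + ?b + (- ?b + d) + (- ?b - d))\<^sup>2 = 0" .
    qed
    moreover have "(1 - ?b) * (1 + ?b) + ?b * (1 + ?b + (- ?b + d) + (- ?b - d)) = (1 - ?b) * (1 + 2 * ?b)"
      "(1 - ?b) * (- ?b + d) + ?b * (1 + ?b + (- ?b + d) + (- ?b - d)) = (1 - ?b) * d"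
      "(1 - ?b) * (- ?b - d) + ?b * (1 + ?b + (- ?b + d) + (- ?b - d)) = (1 - ?b) * - d"
      by (simp_all add: algebra_simps)
    ultimately have "((1 - ?b) * (1 + 2 * ?b)) ^ t + ((1 - ?b) * d) ^ t + ((1 - ?b) * - d) ^ t = 0"
      by (simp only:)
    then have "(1 - ?b) ^ t * ((1 + 2 * ?b) ^ t + d ^ t + (- d) ^ t) = 0"
      unfolding power_mult_distrib distrib_left[symmetric] .
    then have "(1 + 2 * ?b) ^ t + d ^ t + (- d) ^ t = 0"
      using b1 by (auto simp: complex_eq_iff)
    then have "complex_of_real ((1 + 2 * b) ^ t + 2 * (- D) ^ k) = 0"
      by (simp add: k power_mult d add_ac)
    then have "(1 + 2 * b) ^ t + 2 * (- D) ^ k = 0"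
      by (simp only: of_real_eq_0_iff)
    moreover have "0 \<le> (1 + 2 * b) ^ t"
      using b by (intro zero_le_power) simp
    \<comment> \<open>The parity of \<open>k\<close> is unknown; nonnegativity of the left side
      settles the sign of (-D)^k.\<close>
    ultimately have "(1 + 2 * b) ^ t = \<bar>2 * (- D) ^ k\<bar>"
      by linarith
    also have "\<dots> = 2 * D ^ k"
      using D by (simp add: abs_mult power_abs)
    finally have "(1 + 2 * b) ^ t = 2 * D ^ k" .
    moreover have "D ^ k = (1 + 2 * b) ^ k * ((1 + b) / 2) ^ k"
      by (simp add: D_def mult.commute flip: power_mult_distrib)
    moreover have "(1 + 2 * b) ^ t = (1 + 2 * b) ^ k * (1 + 2 * b) ^ k"
      unfolding k(1) mult_2 by (rule power_add)
    ultimately have "(1 + 2 * b) ^ k * (1 + 2 * b) ^ k = (1 + 2 * b) ^ k * (2 * ((1 + b) / 2) ^ k)"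
      by (simp only: mult.left_commute)
    then show ?thesis
      using b by simp
  qed
  define R where "R = (1 - b) * (1 + 2 * b)"
  have R: "R > 0" using b b1 by (simp add: R_def)
  have B: "2 ^ k = 2 * (1 + b) ^ k"
  proof -
    \<comment> \<open>Isotropy of (c, 1, 1) is the quadratic equation c^2 + 4bc + 2 + 2b = 0, whose
      discriminant is negative; \<open>c\<close> is its root in the upper half-plane.\<close>
    define c where "c = Complex (- 2 * b) (sqrt (2 * R))"
    have c: "c\<^sup>2 + 4 * ?b * c + 2 + 2 * ?b = 0"
      using R by (simp add: c_def complex_eq_iff power2_eq_square) (simp add: R_def algebra_simps)
    have "((1 - ?b) * c + ?b * (c + 1 + 1)) ^ t + ((1 - ?b) * 1 + ?b * (c + 1 + 1)) ^ t
      + ((1 - ?b) * 1 + ?b * (c + 1 + 1)) ^ t = 0"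
    proof (rule test)
      show "(1 - ?b) * (c\<^sup>2 + 1\<^sup>2 + 1\<^sup>2) + ?b * (c + 1 + 1)\<^sup>2 = 0"
        using c by (simp add: algebra_simps power2_eq_square)
    qed
    moreover define y where "y = 1 + ?b + ?b * c"
    moreover have "(1 - ?b) * c + ?b * (c + 1 + 1) = c + 2 * ?b" "(1 - ?b) * 1 + ?b * (c + 1 + 1) = y"
      by (simp_all add: y_def algebra_simps)
    ultimately have "(c + 2 * ?b) ^ t = - (2 * y ^ t)"
      by (simp add: algebra_simps add_eq_0_iff2)
    \<comment> \<open>Since \<open>y\<close> is not real in general, only moduli are compared; |c +
      2b|^2 = 2R and |y|^2 = R (1 + b) share the factor R.\<close>
    then have "cmod (c + 2 * ?b) ^ t = 2 * cmod y ^ t"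
      by (metis norm_minus_cancel norm_mult norm_numeral norm_power)
    then have "((cmod (c + 2 * ?b))\<^sup>2) ^ k = 2 * ((cmod y)\<^sup>2) ^ k"
      by (simp add: k power_mult)
    moreover have "(cmod (c + 2 * ?b))\<^sup>2 = 2 * R"
      using R by (simp add: c_def cmod_power2)
    moreover have "(cmod y)\<^sup>2 = R * (1 + b)"
      using R by (simp add: c_def y_def cmod_power2 power_mult_distrib) (simp add: R_def algebra_simps power2_eq_square)
    ultimately have "R ^ k * 2 ^ k = R ^ k * (2 * (1 + b) ^ k)"
      by (simp add: power_mult_distrib mult_ac)
    then show ?thesis
      using R by simp
  qed
  have "(1 + 2 * b) ^ k = 1"
    using A B b1 by (simp add: power_divide)
  then have "1 + 2 * b = 1"
    using b k by (metis less_imp_le one_le_numeral power_eq_iff_eq_base power_one zero_le_one)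
  then show ?thesis by simp
qed

text \<open>Spanning forces at least three points and the power sums exclude four. The three
  remaining points span a space of dimension 3, which yields the strict inequality 1 + 2b > 0 that
  the case of three points requires.\<close>

lemma equiangular_design_orthogonal:
  fixes X :: "(real ^ 'n) set"
  assumes design: "harmonic_index_design t X" and t: "even t" "t \<ge> 4" and n: "CARD('n) \<ge> 3"
    and equi: "\<And>x y. x \<in> X \<Longrightarrow> y \<in> X \<Longrightarrow> x \<noteq> y \<Longrightarrow> x \<bullet> y = b"
  shows "b = 0"
proof -
  have fin: "finite X"
    using design by (simp add: harmonic_index_design_def)
  have dim: "3 \<le> dim X"
    using design_dim[OF design t(1)] n by simp
  then have card: "3 \<le> card X"
    using dim_le_card'[OF fin] by simp
  then have "Suc (Suc (Suc 0)) \<le> card X" by simp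
  then obtain x1 x2 x3 B where X: "X = insert x1 (insert x2 (insert x3 B))"
    and dist: "x1 \<noteq> x2" "x1 \<noteq> x3" "x2 \<noteq> x3"
    unfolding numeral_3_eq_3 card_le_Suc_iff by auto
  have unit: "x1 \<bullet> x1 = 1" "x2 \<bullet> x2 = 1" "x3 \<bullet> x3 = 1"
    using design_norm[OF design] X by auto
  have ip: "x1 \<bullet> x2 = b" "x1 \<bullet> x3 = b" "x2 \<bullet> x3 = b"
    using equi X dist by auto
  have "(x1 - x2) \<bullet> (x1 - x2) = 2 - 2 * b"
    using unit ip by (simp add: inner_diff_left inner_diff_right inner_commute)
  moreover have "(x1 - x2) \<bullet> (x1 - x2) > 0"
    using dist by simp
  ultimately have "b < 1" by simp
  then have "card X = 3"
    using equiangular_design_card_less_4[OF design t _ equi] card by force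
  have sq: "(x1 + x2 + x3) \<bullet> (x1 + x2 + x3) = 3 * (1 + 2 * b)"
    using unit ip by (simp add: inner_add_left inner_add_right inner_commute)
  \<comment> \<open>Otherwise \<open>X\<close> would lie in the span of \<open>x1\<close> and
    \<open>x2\<close>, against dimension at least 3.\<close>
  have "x1 + x2 + x3 \<noteq> 0"
  proof
    assume "x1 + x2 + x3 = 0"
    then have x3: "x3 = - x1 - x2"
      by (simp add: eq_neg_iff_add_eq_0 add_ac algebra_simps)
    have "X = {x1, x2, x3}"
      using \<open>card X = 3\<close> X dist fin by (intro card_subset_eq[symmetric]) auto
    then have "X \<subseteq> span {x1, x2}"
      by (auto simp: x3 span_base intro!: span_diff span_neg)
    then have "dim X \<le> card {x1, x2}"
      by (intro dim_le_card) auto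
    with dim dist show False by simp
  qed
  then have "1 + 2 * b > 0"
    using sq inner_gt_zero_iff[of "x1 + x2 + x3"] by simp
  then show ?thesis
    using equiangular_design_card_3[OF design t(1) _ \<open>b < 1\<close> _ equi \<open>card X = 3\<close>] t by simp
qed

section \<open>Gegenbauer polynomials and zonal harmonics\<close>

text \<open>This is the coefficient of x^(2j) in the Gegenbauer polynomial of degree 2T. It comes
  from the term (r^2 - 2xr)^(T + j) of the binomial series: r^2 is chosen from T - j factors and
  -2xr from the other 2j, whence 4^j.\<close>

definition gegenbauer_coeff :: "real \<Rightarrow> nat \<Rightarrow> nat \<Rightarrow> real" where
  "gegenbauer_coeff a T j = (- a gchoose (T + j)) * real ((T + j) choose (T - j)) * 4 ^ j"

lemma fps_X_plus_const_power_nth: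
  fixes c :: "'a :: comm_ring_1"
  shows "fps_nth ((fps_X + fps_const c) ^ i) m = (if m \<le> i then of_nat (i choose m) * c ^ (i - m) else 0)"
proof -
  have "fps_nth ((fps_X + fps_const c) ^ i) m
      = (\<Sum>k\<le>i. fps_nth (of_nat (i choose k) * fps_X ^ k * fps_const c ^ (i - k)) m)"
    by (simp only: binomial_ring fps_sum_nth)
  also have "\<dots> = (\<Sum>k\<le>i. if k = m then of_nat (i choose m) * c ^ (i - m) else 0)"
    by (intro sum.cong refl) (simp add: fps_const_power fps_of_nat[symmetric] mult.assoc fps_X_power_nth fps_mult_left_const_nth)
  finally show ?thesis by auto
qed

lemma gegenbauer_even:
  assumes "a \<noteq> 0"
  shows "gegenbauer a (2 * T) x = (\<Sum>j\<le>T. gegenbauer_coeff a T j * x ^ (2 * j))"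
proof -
  let ?u = "fps_X ^ 2 - fps_const (2 * x) * fps_X :: real fps"
  let ?c = "\<lambda>i. (- a gchoose i) * (real (i choose (2 * T - i)) * (- (2 * x)) ^ (i - (2 * T - i)))"
  \<comment> \<open>Splitting off r^i leaves the coefficient of r^(2T - i) in (r - 2x)^i, which is
    zero unless T <= i <= 2T.\<close>
  have u: "?u ^ i = fps_X ^ i * (fps_X + fps_const (- (2 * x))) ^ i" for i
    by (simp add: power_mult_distrib[symmetric] algebra_simps power2_eq_square flip: fps_const_neg)
  have coeff: "fps_nth (?u ^ i) (2 * T)
      = (if T \<le> i \<and> i \<le> 2 * T then real (i choose (2 * T - i)) * (- (2 * x)) ^ (i - (2 * T - i)) else 0)"
    if "i \<le> 2 * T" for i
    using that by (auto simp: u fps_X_power_mult_nth fps_X_plus_const_power_nth simp del: fps_const_neg)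
  have "gegenbauer a (2 * T) x = (\<Sum>i=0..2*T. (- a gchoose i) * fps_nth (?u ^ i) (2 * T))"
    using assms by (simp add: gegenbauer_def fps_compose_nth)
  also have "\<dots> = (\<Sum>i=0..2*T. if i \<in> {T..2*T} then ?c i else 0)"
    by (intro sum.cong refl) (simp add: coeff)
  also have "\<dots> = (\<Sum>i\<in>{T..2*T}. ?c i)"
    by (rule sum.mono_neutral_cong_right) auto
  also have "\<dots> = (\<Sum>j\<le>T. ?c (T + j))"
    by (rule sum.reindex_bij_witness[of _ "\<lambda>j. T + j" "\<lambda>i. i - T"]) auto
  also have "\<dots> = (\<Sum>j\<le>T. gegenbauer_coeff a T j * x ^ (2 * j))"
  proof (intro sum.cong refl)
    fix j assume "j \<in> {..T}"
    then have "2 * T - (T + j) = T - j" "T + j - (T - j) = 2 * j" by auto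
    then show "?c (T + j) = gegenbauer_coeff a T j * x ^ (2 * j)"
      by (simp add: gegenbauer_coeff_def power_mult power_mult_distrib)
  qed
  finally show ?thesis .
qed

text \<open>Harmonicity of the zonal polynomial and the Gegenbauer differential equation both reduce
  to this two-term recurrence. It follows from the ratios of consecutive binomial
  coefficients.\<close>

lemma gegenbauer_coeff_rec:
  assumes "j < T"
  shows "gegenbauer_coeff a T (Suc j) * (real (2 * j + 2) * real (2 * j + 1))
      = - gegenbauer_coeff a T j * (2 * real (T - j) * (2 * real T + 2 * real j + 2 * a))"
proof -
  define N where "N = T + j"
  define m where "m = T - j - 1"
  have m: "T - j = Suc m" and N: "T + j = N" "T + Suc j = Suc N" "T - Suc j = m"
    and Nm: "N - m = 2 * j + 1" "Suc N - m = 2 * j + 2"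
    using assms by (auto simp: N_def m_def)
  have "(N - m) * (N choose m) = Suc m * (N choose Suc m)"
    by (simp only: binomial_absorb_comp binomial_absorption)
  moreover have "(Suc N - m) * (Suc N choose m) = Suc N * (N choose m)"
    using binomial_absorb_comp[of "Suc N" m] by simp
  ultimately have "(Suc N choose m) * ((2 * j + 2) * (2 * j + 1)) = Suc N * (Suc m * (N choose Suc m))"
    by (metis Nm mult.assoc mult.commute)
  then have bin: "real (Suc N choose m) * (real (2 * j + 2) * real (2 * j + 1))
      = real (Suc N) * (real (Suc m) * real (N choose Suc m))"
    by (metis of_nat_mult)
  have gb: "real (Suc N) * (- a gchoose Suc N) = - (a + real N) * (- a gchoose N)"
    using gbinomial_mult_1[of "- a" N] by (simp add: algebra_simps)
  have "gegenbauer_coeff a T (Suc j) * (real (2 * j + 2) * real (2 * j + 1))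
      = (- a gchoose Suc N) * 4 ^ Suc j * (real (Suc N choose m) * (real (2 * j + 2) * real (2 * j + 1)))"
    by (simp only: gegenbauer_coeff_def N mult_ac)
  also have "\<dots> = (real (Suc N) * (- a gchoose Suc N)) * 4 ^ Suc j * (real (Suc m) * real (N choose Suc m))"
    unfolding bin by (simp only: mult_ac)
  also have "\<dots> = - ((- a gchoose N) * real (N choose Suc m) * 4 ^ j) * (2 * real (Suc m) * (2 * real N + 2 * a))"
    unfolding gb power_Suc by algebra
  finally show ?thesis
    unfolding gegenbauer_coeff_def m N(1) by (simp add: N_def algebra_simps)
qed

text \<open>A second-order operator sends the \<open>j\<close>-th monomial to a part
  \<open>A j\<close> of lower degree and a part \<open>B j\<close> of unchanged degree. The
  recurrence cancels \<open>B j\<close> against \<open>A (Suc j)\<close>, and the two boundary terms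
  are zero.\<close>

lemma sum_power_recurrence_cancel:
  fixes d A B :: "nat \<Rightarrow> real"
  assumes "A 0 = 0" "B T = 0" "\<And>j. j < T \<Longrightarrow> A (Suc j) + B j = 0"
  shows "(\<Sum>j\<le>T. A j + B j) = 0"
proof -
  have "(\<Sum>j\<le>T. A j) = (\<Sum>j<T. A (Suc j))"
    using assms(1) by (simp add: sum.atMost_shift)
  moreover have "(\<Sum>j\<le>T. B j) = (\<Sum>j<T. B j)"
    using assms(2) by (simp add: lessThan_Suc_atMost[symmetric])
  ultimately have "(\<Sum>j\<le>T. A j + B j) = (\<Sum>j<T. A (Suc j) + B j)"
    by (simp add: sum.distrib)
  with assms(3) show ?thesis by simp
qed

text \<open>Along the i-th axis <x, y> is affine with slope y_i, and <x, x> is quadratic. Summation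
  over i turns the products of coordinates into <y, y>, <x, y> and <x, x>. Truncated exponents occur
  only next to a factor that is then 0.\<close>

lemma laplacian_zonal:
  fixes x y :: "real ^ 'n"
  shows "laplacian (\<lambda>x. \<Sum>j\<in>K. d j * ((x \<bullet> y) ^ p j * (x \<bullet> x) ^ k j)) x =
    (\<Sum>j\<in>K. d j * (real (p j) * real (p j - 1) * (y \<bullet> y) * ((x \<bullet> y) ^ (p j - 2) * (x \<bullet> x) ^ k j)) +
       d j * (2 * real (k j) * (2 * real (p j) + real CARD('n) + 2 * real (k j - 1)) * ((x \<bullet> y) ^ p j * (x \<bullet> x) ^ (k j - 1))))"
proof -
  let ?f1 = "\<lambda>i x j. real (p j) * y $ i * (x \<bullet> y) ^ (p j - 1) * (x \<bullet> x) ^ k j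
      + real (k j) * (2 * x $ i) * (x \<bullet> y) ^ p j * (x \<bullet> x) ^ (k j - 1)"
  let ?f2 = "\<lambda>i x j. real (p j) * real (p j - 1) * (y $ i) ^ 2 * (x \<bullet> y) ^ (p j - 2) * (x \<bullet> x) ^ k j
      + 4 * real (p j) * real (k j) * (x $ i * y $ i) * (x \<bullet> y) ^ (p j - 1) * (x \<bullet> x) ^ (k j - 1)
      + 2 * real (k j) * (x \<bullet> y) ^ p j * (x \<bullet> x) ^ (k j - 1)
      + 4 * real (k j) * real (k j - 1) * (x $ i) ^ 2 * (x \<bullet> y) ^ p j * (x \<bullet> x) ^ (k j - 2)"
  have sh1: "(x + s *\<^sub>R axis i 1) \<bullet> y = x \<bullet> y + s * y $ i" for x s i
    by (simp add: inner_add_left inner_axis')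
  have sh2: "(x + s *\<^sub>R axis i 1) \<bullet> (x + s *\<^sub>R axis i 1) = x \<bullet> x + s * (2 * x $ i) + s\<^sup>2" for x :: "real ^ 'n" and s i
    by (simp add: inner_add_left inner_add_right inner_axis inner_axis' algebra_simps power2_eq_square)
  have sh3: "(x + s *\<^sub>R axis i 1) $ i = x $ i + s" for x :: "real ^ 'n" and s i
    by simp
  have p1: "partial i (\<lambda>x. \<Sum>j\<in>K. d j * ((x \<bullet> y) ^ p j * (x \<bullet> x) ^ k j)) = (\<lambda>x. \<Sum>j\<in>K. d j * ?f1 i x j)" for i
    by (rule ext, rule partialI, unfold sh1 sh2)
      (auto intro!: derivative_eq_intros sum.cong simp: algebra_simps)
  have p2: "partial i (\<lambda>x. \<Sum>j\<in>K. d j * ?f1 i x j) x = (\<Sum>j\<in>K. d j * ?f2 i x j)" for i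
    by (rule partialI, unfold sh1 sh2 sh3)
      (auto intro!: derivative_eq_intros sum.cong simp: algebra_simps power2_eq_square numeral_2_eq_2)
  have "laplacian (\<lambda>x. \<Sum>j\<in>K. d j * ((x \<bullet> y) ^ p j * (x \<bullet> x) ^ k j)) x
      = (\<Sum>j\<in>K. d j * (\<Sum>i\<in>UNIV. ?f2 i x j))"
    unfolding laplacian_def p1 p2 by (subst sum.swap) (simp only: sum_distrib_left)
  also have "\<dots> = (\<Sum>j\<in>K. d j * (real (p j) * real (p j - 1) * (y \<bullet> y) * ((x \<bullet> y) ^ (p j - 2) * (x \<bullet> x) ^ k j)) +
       d j * (2 * real (k j) * (2 * real (p j) + real CARD('n) + 2 * real (k j - 1)) * ((x \<bullet> y) ^ p j * (x \<bullet> x) ^ (k j - 1))))"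
  proof (intro sum.cong refl)
    fix j
    have h1: "(\<Sum>i\<in>UNIV. ?f2 i x j) = real (p j) * real (p j - 1) * (y \<bullet> y) * (x \<bullet> y) ^ (p j - 2) * (x \<bullet> x) ^ k j
      + 4 * (real (p j) * (x \<bullet> y) * (x \<bullet> y) ^ (p j - 1)) * real (k j) * (x \<bullet> x) ^ (k j - 1)
      + 2 * real (k j) * real CARD('n) * (x \<bullet> y) ^ p j * (x \<bullet> x) ^ (k j - 1)
      + 4 * real (k j) * (real (k j - 1) * (x \<bullet> x) * (x \<bullet> x) ^ (k j - 2)) * (x \<bullet> y) ^ p j"
      by (simp add: inner_vec_def[of x] inner_vec_def[of y] sum.distrib sum_distrib_left sum_distrib_right power2_eq_square
          mult_ac del: of_nat_diff)
    \<comment> \<open>The numeric factor must stay: without it the identity fails at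
      \<open>p j = 0\<close>, where subtraction truncates. The same holds for
      \<open>h3\<close>.\<close>
    have h2: "real (p j) * (x \<bullet> y) * (x \<bullet> y) ^ (p j - 1) = real (p j) * (x \<bullet> y) ^ p j"
      by (cases "p j") auto
    have h3: "real (k j - 1) * (x \<bullet> x) * (x \<bullet> x) ^ (k j - 2) = real (k j - 1) * (x \<bullet> x) ^ (k j - 1)"
    proof (cases "k j - 1")
      case (Suc m)
      then have "k j = Suc (Suc m)" by simp
      then show ?thesis by simp
    qed simp
    have ring: "d j * (A + 4 * (q * S) * r * R + 2 * r * n * S * R + 4 * r * (r' * R) * S)
        = d j * A + d j * (2 * r * (2 * q + n + 2 * r') * (S * R))" for A q S r R n r' :: real
      by (simp add: algebra_simps)
    show "d j * (\<Sum>i\<in>UNIV. ?f2 i x j) = d j * (real (p j) * real (p j - 1) * (y \<bullet> y) * ((x \<bullet> y) ^ (p j - 2) * (x \<bullet> x) ^ k j)) +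
       d j * (2 * real (k j) * (2 * real (p j) + real CARD('n) + 2 * real (k j - 1)) * ((x \<bullet> y) ^ p j * (x \<bullet> x) ^ (k j - 1)))"
      unfolding h1 h2 h3 ring by (simp only: mult.assoc)
  qed
  finally show ?thesis .
qed

text \<open>The polynomial is |x|^(2T) f(<x, y>/|x|) for f(s) the sum of the d_j s^(2j), and the
  recurrence is that of the Gegenbauer parameter a = (n - 2)/2.\<close>

lemma zonal_in_Harm:
  fixes y :: "real ^ 'n"
  assumes "norm y = 1"
    and rec: "\<And>j. j < T \<Longrightarrow> d (Suc j) * (real (2 * j + 2) * real (2 * j + 1))
      = - d j * (2 * real (T - j) * (2 * real T + 2 * real j + real CARD('n) - 2))"
  shows "(\<lambda>x. \<Sum>j\<le>T. d j * ((x \<bullet> y) ^ (2 * j) * (x \<bullet> x) ^ (T - j))) \<in> Harm (2 * T)"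
proof -
  have yy: "y \<bullet> y = 1"
    using assms(1) by (simp add: norm_eq_1)
  have "homogeneous_polynomial (2 * T) (\<lambda>x. \<Sum>j\<le>T. d j * ((x \<bullet> y) ^ (2 * j) * (x \<bullet> x) ^ (T - j)))"
  proof (intro homogeneous_polynomial_sum homogeneous_polynomial_scale)
    fix j assume "j \<in> {..T}"
    then have "2 * j + 2 * (T - j) = 2 * T" by simp
    then show "homogeneous_polynomial (2 * T) (\<lambda>x. (x \<bullet> y) ^ (2 * j) * (x \<bullet> x) ^ (T - j))"
      using homogeneous_polynomial_zonal[of "2 * j" "T - j" y] by simp
  qed
  moreover have "laplacian (\<lambda>x. \<Sum>j\<le>T. d j * ((x \<bullet> y) ^ (2 * j) * (x \<bullet> x) ^ (T - j))) x = 0" for x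
    unfolding laplacian_zonal yy
  proof (rule sum_power_recurrence_cancel)
    \<comment> \<open>Both terms carry the monomial <x, y>^(2j) <x, x>^(T - j - 1); the recurrence
      makes their coefficients cancel.\<close>
    fix j assume j: "j < T"
    have *: "T - Suc j = T - j - 1" "2 * Suc j - 2 = 2 * j" "2 * Suc j - 1 = 2 * j + 1"
      "real (2 * Suc j) = real (2 * j + 2)"
      using j by auto
    have F: "2 * real (2 * j) + real CARD('n) + 2 * real (T - j - 1) = 2 * real T + 2 * real j + real CARD('n) - 2"
      using j by (simp add: of_nat_diff)
    have factor: "d' * (a * b * 1 * M) + e * (c * f * M) = (d' * (a * b) + e * (c * f)) * M"
      for a b c d' e f M :: real
      by (simp add: algebra_simps)
    show "d (Suc j) * (real (2 * Suc j) * real (2 * Suc j - 1) * 1 * ((x \<bullet> y) ^ (2 * Suc j - 2) * (x \<bullet> x) ^ (T - Suc j)))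
       + d j * (2 * real (T - j) * (2 * real (2 * j) + real CARD('n) + 2 * real (T - j - 1)) * ((x \<bullet> y) ^ (2 * j) * (x \<bullet> x) ^ (T - j - 1))) = 0"
      unfolding * factor F rec[OF j] by simp
  qed auto
  ultimately show ?thesis
    by (simp add: Harm_def)
qed

text \<open>On the unit sphere the zonal harmonic with pole \<open>y\<close> restricts to the
  Gegenbauer polynomial in <x, y>. The bound on the dimension makes the parameter nonzero, so that
  the polynomial formula applies.\<close>

lemma design_zonal_sum:
  fixes X :: "(real ^ 'n) set"
  assumes design: "harmonic_index_design (2 * T) X" and y: "norm y = 1" and n: "CARD('n) \<ge> 3"
  shows "(\<Sum>x\<in>X. Q_poly CARD('n) (2 * T) (x \<bullet> y)) = 0"
proof -
  define a where "a = (real CARD('n) - 2) / 2"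
  have a: "a \<noteq> 0" "real CARD('n) - 2 = 2 * a"
    using n by (auto simp: a_def)
  have dim: "c + real CARD('n) - 2 = c + 2 * a" for c
    using a(2) by simp
  define Z where "Z = (\<lambda>x. \<Sum>j\<le>T. gegenbauer_coeff a T j * ((x \<bullet> y) ^ (2 * j) * (x \<bullet> x) ^ (T - j)))"
  have "Z \<in> Harm (2 * T)"
    unfolding Z_def using y
    by (rule zonal_in_Harm) (simp only: dim gegenbauer_coeff_rec)
  then have "(\<Sum>x\<in>X. Z x) = 0"
    using design by (simp add: harmonic_index_design_def)
  moreover have "Z x = gegenbauer a (2 * T) (x \<bullet> y)" if "x \<in> X" for x
  proof -
    have "x \<bullet> x = 1"
      by (rule design_norm[OF design that])
    then show ?thesis
      by (simp add: Z_def gegenbauer_even[OF a(1)])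
  qed
  ultimately show ?thesis
    by (simp add: Q_poly_def a_def[symmetric] sum_distrib_left[symmetric])
qed

section \<open>The Gegenbauer equation and Sonine's function\<close>

lemma even_polynomial_deriv:
  fixes d :: "nat \<Rightarrow> real"
  shows "((\<lambda>x. \<Sum>j\<le>T. d j * x ^ (2 * j)) has_real_derivative
           (\<Sum>j\<le>T. d j * (real (2 * j) * x ^ (2 * j - 1)))) (at x)"
    and "((\<lambda>x. \<Sum>j\<le>T. d j * (real (2 * j) * x ^ (2 * j - 1))) has_real_derivative
           (\<Sum>j\<le>T. d j * (real (2 * j) * (real (2 * j - 1) * x ^ (2 * j - 2))))) (at x)"
  by (auto intro!: derivative_eq_intros sum.cong simp: numeral_2_eq_2)

text \<open>The second part of the operator multiplies x^(2j) by 2T(2T + 2a) - 2j(2j + 2a) = 2(T -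
  j)(2T + 2j + 2a), which is the factor in the recurrence.\<close>

lemma gegenbauer_ODE:
  fixes d :: "nat \<Rightarrow> real"
  assumes rec: "\<And>j. j < T \<Longrightarrow> d (Suc j) * (real (2 * j + 2) * real (2 * j + 1))
      = - d j * (2 * real (T - j) * (2 * real T + 2 * real j + 2 * a))"
  shows "(1 - x\<^sup>2) * (\<Sum>j\<le>T. d j * (real (2 * j) * (real (2 * j - 1) * x ^ (2 * j - 2))))
      - (2 * a + 1) * x * (\<Sum>j\<le>T. d j * (real (2 * j) * x ^ (2 * j - 1)))
      + 2 * real T * (2 * real T + 2 * a) * (\<Sum>j\<le>T. d j * x ^ (2 * j)) = 0"
proof -
  let ?A = "\<lambda>j. d j * (real (2 * j) * (real (2 * j - 1) * x ^ (2 * j - 2)))"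
  let ?B = "\<lambda>j. d j * (2 * real (T - j) * (2 * real T + 2 * real j + 2 * a)) * x ^ (2 * j)"
  have "(1 - x\<^sup>2) * ?A j - (2 * a + 1) * x * (d j * (real (2 * j) * x ^ (2 * j - 1)))
      + 2 * real T * (2 * real T + 2 * a) * (d j * x ^ (2 * j)) = ?A j + ?B j" if "j \<le> T" for j
  proof (cases j)
    case (Suc i)
    have T: "real (T - j) = real T - real j" using that by simp
    have pw: "x ^ (2 * j) = x\<^sup>2 * x ^ (2 * i)" "x ^ (2 * j - 1) = x * x ^ (2 * i)" "x ^ (2 * j - 2) = x ^ (2 * i)"
      "real (2 * j - 1) = 2 * real j - 1" "real (2 * j) = 2 * real j"
      by (simp_all add: Suc power2_eq_square mult.assoc)
    have "(1 - x\<^sup>2) * (D * (2 * J * ((2 * J - 1) * P))) - (2 * a + 1) * x * (D * (2 * J * (x * P)))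
        + 2 * \<tau> * (2 * \<tau> + 2 * a) * (D * (x\<^sup>2 * P))
        = D * (2 * J * ((2 * J - 1) * P)) + D * (2 * (\<tau> - J) * (2 * \<tau> + 2 * J + 2 * a)) * (x\<^sup>2 * P)"
      for D J P \<tau> :: real
      by algebra
    then show ?thesis
      unfolding T pw .
  qed simp
  then have "(\<Sum>j\<le>T. (1 - x\<^sup>2) * ?A j - (2 * a + 1) * x * (d j * (real (2 * j) * x ^ (2 * j - 1)))
      + 2 * real T * (2 * real T + 2 * a) * (d j * x ^ (2 * j))) = (\<Sum>j\<le>T. ?A j + ?B j)"
    by (intro sum.cong) auto
  also have "\<dots> = 0"
  proof (rule sum_power_recurrence_cancel)
    fix j assume j: "j < T"
    have "?A (Suc j) = d (Suc j) * (real (2 * j + 2) * real (2 * j + 1)) * x ^ (2 * j)"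
      by simp
    then show "?A (Suc j) + ?B j = 0"
      unfolding rec[OF j] by simp
  qed auto
  finally show ?thesis
    by (simp only: sum_distrib_left sum_subtractf sum.distrib)
qed

locale gegenbauer_ode =
  fixes f f' f'' :: "real \<Rightarrow> real" and a N :: real
  assumes deriv: "(f has_real_derivative f' x) (at x)"
    and deriv': "(f' has_real_derivative f'' x) (at x)"
    and ode: "(1 - x\<^sup>2) * f'' x - (2 * a + 1) * x * f' x + N * f x = 0"
    and a_pos: "a > 0" and N_pos: "N > 0"
begin

text \<open>Monotone away from \<open>0\<close> and equal to \<open>(f x)\<^sup>2\<close> at critical points, so it separates
  the extremal values on the nonnegative half-line.\<close>

definition sonine :: "real \<Rightarrow> real" where
  "sonine x = (f x)\<^sup>2 + (1 - x\<^sup>2) * (f' x)\<^sup>2 / N"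

lemma sonine_deriv: "(sonine has_real_derivative 4 * a * x * (f' x)\<^sup>2 / N) (at x)"
proof -
  have "(sonine has_real_derivative
      (2 * f x * f' x + (- (2 * x) * (f' x)\<^sup>2 + (1 - x\<^sup>2) * (2 * f' x * f'' x)) / N)) (at x)"
    unfolding sonine_def
    using N_pos by (auto intro!: derivative_eq_intros deriv deriv' simp: power2_eq_square)
  also have "2 * f x * f' x + (- (2 * x) * (f' x)\<^sup>2 + (1 - x\<^sup>2) * (2 * f' x * f'' x)) / N
      = (2 * f' x * (N * f x + (1 - x\<^sup>2) * f'' x - x * f' x)) / N"
    using N_pos by (simp add: field_simps power2_eq_square)
  \<comment> \<open>The equation eliminates both f and f'', leaving a square times x in the
    derivative.\<close>
  also have "N * f x + (1 - x\<^sup>2) * f'' x - x * f' x = 2 * a * x * f' x"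
    using ode[of x] by (simp add: algebra_simps)
  also have "2 * f' x * (2 * a * x * f' x) / N = 4 * a * x * (f' x)\<^sup>2 / N"
    by (simp add: power2_eq_square)
  finally show ?thesis .
qed

lemma sonine_mono:
  assumes "0 \<le> x" "x \<le> y"
  shows "sonine x \<le> sonine y"
proof (rule DERIV_nonneg_imp_nondecreasing[OF assms(2)])
  fix z assume "x \<le> z" "z \<le> y"
  then show "\<exists>D. (sonine has_real_derivative D) (at z) \<and> 0 \<le> D"
    using sonine_deriv[of z] a_pos N_pos assms(1) by (intro exI[of _ "4 * a * z * (f' z)\<^sup>2 / N"]) auto
qed

text \<open>Equal values at two critical points make the monotone \<open>sonine\<close> constant
  between them. Then f' = 0 there, hence f'' = 0, and the equation gives f = 0, against constancy of
  f from \<open>x\<close> on.\<close>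

lemma critical_values_distinct:
  assumes xy: "0 \<le> x" "x < y" and crit: "f' x = 0" "f' y = 0" and eq: "f x = f y" and nz: "f x \<noteq> 0"
  shows False
proof -
  have "sonine x = sonine y"
    using crit eq by (simp add: sonine_def)
  then have const: "sonine z = sonine x" if "z \<in> {x<..<y}" for z
    using sonine_mono[of x z] sonine_mono[of z y] that xy by auto
  have f'0: "f' z = 0" if z: "z \<in> {x<..<y}" for z
  proof -
    have "(sonine has_real_derivative 0) (at z)"
      by (rule has_field_derivative_transform_within_open[of "\<lambda>_. sonine x" _ _ "{x<..<y}"])
        (use z const in auto)
    then have "4 * a * z * (f' z)\<^sup>2 / N = 0"
      using sonine_deriv DERIV_unique by blast
    then show ?thesis
      using z xy a_pos N_pos by auto
  qed
  have f0: "f z = 0" if z: "z \<in> {x<..<y}" for z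
  proof -
    have "(f' has_real_derivative 0) (at z)"
      by (rule has_field_derivative_transform_within_open[of "\<lambda>_. 0" _ _ "{x<..<y}"])
        (use z f'0 in auto)
    then have "f'' z = 0"
      using deriv' DERIV_unique by blast
    then show ?thesis
      using ode[of z] f'0[OF z] N_pos by simp
  qed
  define z where "z = (x + y) / 2"
  have z: "x < z" "z \<in> {x<..<y}"
    using xy by (auto simp: z_def)
  have "f z = f x"
  proof (rule DERIV_isconst_end[OF z(1)])
    show "continuous_on {x..z} f"
      by (intro continuous_at_imp_continuous_on ballI DERIV_isCont[OF deriv])
    show "(f has_real_derivative 0) (at w)" if "x < w" "w < z" for w
      using deriv[of w] f'0[of w] that z by simp
  qed
  with f0 z nz show False by simp
qed

end

lemma gegenbauer_odeI:
  fixes d :: "nat \<Rightarrow> real"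
  assumes "\<And>j. j < T \<Longrightarrow> d (Suc j) * (real (2 * j + 2) * real (2 * j + 1))
      = - d j * (2 * real (T - j) * (2 * real T + 2 * real j + 2 * a))"
    and "a > 0" "T > 0"
  shows "gegenbauer_ode (\<lambda>x. \<Sum>j\<le>T. d j * x ^ (2 * j)) (\<lambda>x. \<Sum>j\<le>T. d j * (real (2 * j) * x ^ (2 * j - 1)))
    (\<lambda>x. \<Sum>j\<le>T. d j * (real (2 * j) * (real (2 * j - 1) * x ^ (2 * j - 2)))) a (2 * real T * (2 * real T + 2 * a))"
  using assms by unfold_locales (simp_all only: even_polynomial_deriv gegenbauer_ODE, auto)

text \<open>Since f(1) > 0 > m, minimisers are interior and hence critical points. Evenness moves
  them to the nonnegative half-line, where two critical points cannot share the nonzero value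
  \<open>m\<close>.\<close>

lemma even_gegenbauer_minimizer_unique:
  fixes d :: "nat \<Rightarrow> real"
  assumes rec: "\<And>j. j < T \<Longrightarrow> d (Suc j) * (real (2 * j + 2) * real (2 * j + 1))
      = - d j * (2 * real (T - j) * (2 * real T + 2 * real j + 2 * a))"
    and "a > 0" "T > 0"
    and f: "\<And>x. f x = (\<Sum>j\<le>T. d j * x ^ (2 * j))"
    and "f 1 > 0" "m < 0" and min: "\<And>x. x \<in> {-1..1} \<Longrightarrow> m \<le> f x"
    and "u \<in> {-1..1}" "v \<in> {-1..1}" "f u = m" "f v = m"
  shows "\<bar>u\<bar> = \<bar>v\<bar>"
proof -
  define f' where "f' = (\<lambda>x. \<Sum>j\<le>T. d j * (real (2 * j) * x ^ (2 * j - 1)))"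
  interpret gegenbauer_ode f f' "\<lambda>x. \<Sum>j\<le>T. d j * (real (2 * j) * (real (2 * j - 1) * x ^ (2 * j - 2)))"
      a "2 * real T * (2 * real T + 2 * a)"
    unfolding f'_def ext[of f, OF f] using rec \<open>a > 0\<close> \<open>T > 0\<close> by (rule gegenbauer_odeI)
  have even: "f \<bar>x\<bar> = f x" for x
    by (simp add: f power_even_abs)
  have crit: "\<bar>x\<bar> < 1 \<and> f' \<bar>x\<bar> = 0" if x: "x \<in> {-1..1}" "f x = m" for x
  proof
    show less: "\<bar>x\<bar> < 1"
    proof (rule ccontr)
      assume "\<not> \<bar>x\<bar> < 1"
      then have "\<bar>x\<bar> = 1" using x(1) by auto
      with even[of x] x(2) \<open>f 1 > 0\<close> \<open>m < 0\<close> show False by simp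
    qed
    show "f' \<bar>x\<bar> = 0"
    proof (rule DERIV_local_min[OF deriv])
      show "0 < 1 - \<bar>x\<bar>" using less by simp
      show "\<forall>y. \<bar>\<bar>x\<bar> - y\<bar> < 1 - \<bar>x\<bar> \<longrightarrow> f \<bar>x\<bar> \<le> f y"
      proof (intro allI impI)
        fix y assume "\<bar>\<bar>x\<bar> - y\<bar> < 1 - \<bar>x\<bar>"
        then have "y \<in> {-1..1}" by auto
        from min[OF this] show "f \<bar>x\<bar> \<le> f y" by (simp add: even x(2))
      qed
    qed
  qed
  have "\<not> \<bar>p\<bar> < \<bar>q\<bar>" if "p \<in> {-1..1}" "q \<in> {-1..1}" "f p = m" "f q = m" for p q
    using critical_values_distinct[of "\<bar>p\<bar>" "\<bar>q\<bar>"] crit[of p] crit[of q] that even[of p] even[of q] \<open>m < 0\<close>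
    by auto
  from this[of u v] this[of v u] assms show ?thesis
    by force
qed

text \<open>This justifies the normalisation by \<open>A_const\<close>. The weight 1 - x^2 vanishes
  at 1, so a zero there gives \<open>sonine 1 = 0\<close>; monotonicity then forces the nonzero
  constant term to vanish.\<close>

lemma gegenbauer_even_at_1_nonzero:
  assumes "a > 0" "T > 0"
  shows "gegenbauer a (2 * T) 1 \<noteq> 0"
proof
  assume "gegenbauer a (2 * T) 1 = 0"
  let ?d = "gegenbauer_coeff a T"
  interpret gegenbauer_ode "\<lambda>x. \<Sum>j\<le>T. ?d j * x ^ (2 * j)" "\<lambda>x. \<Sum>j\<le>T. ?d j * (real (2 * j) * x ^ (2 * j - 1))"
      "\<lambda>x. \<Sum>j\<le>T. ?d j * (real (2 * j) * (real (2 * j - 1) * x ^ (2 * j - 2)))"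
      a "2 * real T * (2 * real T + 2 * a)"
    using assms by (intro gegenbauer_odeI gegenbauer_coeff_rec)
  have at0: "(\<Sum>j\<le>T. ?d j * 0 ^ (2 * j)) = ?d 0"
    by (simp add: sum.atMost_shift)
  have "sonine 0 \<le> sonine 1"
    by (rule sonine_mono) auto
  also have "sonine 1 = 0"
  proof -
    have "(\<Sum>j\<le>T. ?d j * 1 ^ (2 * j)) = 0"
      using \<open>gegenbauer a (2 * T) 1 = 0\<close> assms gegenbauer_even[of a T 1] by simp
    then show ?thesis
      unfolding sonine_def by simp
  qed
  finally have "(?d 0)\<^sup>2 + (\<Sum>j\<le>T. ?d j * (real (2 * j) * 0 ^ (2 * j - 1)))\<^sup>2 / (2 * real T * (2 * real T + 2 * a)) \<le> 0"
    unfolding sonine_def at0 by simp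
  moreover have "0 \<le> (\<Sum>j\<le>T. ?d j * (real (2 * j) * 0 ^ (2 * j - 1)))\<^sup>2 / (2 * real T * (2 * real T + 2 * a))"
    using assms by (intro divide_nonneg_pos) auto
  ultimately have "?d 0 = 0"
    by (smt (verit) zero_less_power2)
  \<comment> \<open>Up to \<open>fact T\<close> this is the product of the negative numbers -a, -a -
    1, ..., -a - T + 1.\<close>
  moreover have "(- a gchoose T) \<noteq> 0"
    using assms by (auto simp: gbinomial_prod_rev)
  ultimately show False
    by (simp add: gegenbauer_coeff_def)
qed

section \<open>Designs attaining the bound\<close>

lemma harm_dim_pos:
  assumes "n \<ge> 3" "t \<ge> 2"
  shows "harm_dim n t > 0"
proof -
  obtain s where t: "t = Suc (Suc s)"
    using assms(2) by (metis add_2_eq_Suc less_eqE)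
  define M where "M = n + t - 3"
  have M: "n + t - 1 = Suc (Suc M)" "Suc s \<le> M"
    using assms by (auto simp: M_def t)
  \<comment> \<open>Pascal's rule, applied twice, leaves a surplus containing
    \<open>M choose Suc s\<close>, which is positive because \<open>Suc s \<le> M\<close>.\<close>
  have "(M choose s) < (Suc (Suc M) choose t)"
    using M(2) by (simp add: t zero_less_binomial add.assoc)
  moreover have "harm_dim n t = real (Suc (Suc M) choose t) - real (M choose s)"
    unfolding harm_dim_def M(1) M_def[symmetric] by (simp only: t) simp
  ultimately show ?thesis
    by simp
qed

lemma compact_LEAST:
  fixes S :: "real set"
  assumes "compact S" "S \<noteq> {}"
  shows "(LEAST v. v \<in> S) \<in> S" and "\<And>v. v \<in> S \<Longrightarrow> (LEAST v. v \<in> S) \<le> v"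
proof -
  obtain m where m: "m \<in> S" "\<And>v. v \<in> S \<Longrightarrow> m \<le> v"
    using compact_attains_inf[OF assms] by blast
  then have "(LEAST v. v \<in> S) = m"
    by (intro Least_equality) auto
  with m show "(LEAST v. v \<in> S) \<in> S" and "\<And>v. v \<in> S \<Longrightarrow> (LEAST v. v \<in> S) \<le> v"
    by auto
qed

lemma harm_dim_2: "t > 0 \<Longrightarrow> harm_dim 2 t = 2"
proof -
  assume "t > 0"
  consider "t = 1" | s where "t = Suc (Suc s)"
    using \<open>t > 0\<close> by (cases t rule: nat.exhaust) (auto, metis not0_implies_Suc)
  then show ?thesis
  proof cases
    case 2
    have "(Suc s choose s) = Suc s" "(Suc (Suc (Suc s)) choose Suc (Suc s)) = Suc (Suc (Suc s))"
      by simp_all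
    then show ?thesis
      unfolding harm_dim_def 2 by simp
  qed (simp add: harm_dim_def)
qed

text \<open>On the circle Q(x) = 2 cos(t arccos x), with minimum -2 at x = cos(pi/t).\<close>

lemma b_const_2:
  assumes "t > 0"
  shows "b_const 2 t = 2"
proof -
  have Q: "Q_poly 2 t x = 2 * cos (real t * arccos x)" for x
    using harm_dim_2[OF assms] by (simp add: Q_poly_def A_const_def gegenbauer_def)
  have "(LEAST v. v \<in> Q_poly 2 t ` {-1..1}) = - 2"
  proof (rule Least_equality)
    have "pi / t \<in> {0..pi}"
      using assms by (simp add: divide_le_eq)
    then have "Q_poly 2 t (cos (pi / t)) = - 2"
      using assms by (simp add: Q arccos_cos)
    then show "- 2 \<in> Q_poly 2 t ` {-1..1}"
      by (metis atLeastAtMost_iff cos_ge_minus_one cos_le_one imageI)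
    show "- 2 \<le> v" if "v \<in> Q_poly 2 t ` {-1..1}" for v
      using that by (auto simp: Q)
  qed
  then show ?thesis
    by (simp add: b_const_def c_const_def harm_dim_2[OF assms])
qed

lemma inner_unit_in_interval:
  assumes "x \<bullet> x = 1" "y \<bullet> y = 1"
  shows "x \<bullet> y \<in> {-1..1}"
proof -
  have "norm x = 1" "norm y = 1" using assms by (simp_all add: norm_eq_1)
  then show ?thesis
    using Cauchy_Schwarz_ineq2[of x y] by (simp add: abs_le_iff)
qed

lemma tight_design_inner_products:
  fixes X :: "(real ^ 'n) set" and T :: nat
  defines "Q \<equiv> Q_poly CARD('n) (2 * T)" and "m \<equiv> - c_const CARD('n) (2 * T)"
  assumes design: "harmonic_index_design (2 * T) X" and n: "CARD('n) \<ge> 3"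
    and card: "real (card X) = b_const CARD('n) (2 * T)"
  shows "m < 0" "Q 1 > 0" "\<And>x. x \<in> {-1..1} \<Longrightarrow> m \<le> Q x" "card X \<ge> 2"
    "\<And>x y. x \<in> X \<Longrightarrow> y \<in> X \<Longrightarrow> x \<noteq> y \<Longrightarrow> Q (x \<bullet> y) = m"
proof -
  define a where "a = (real CARD('n) - 2) / 2"
  define h where "h = harm_dim CARD('n) (2 * T)"
  have a: "a > 0"
    using n by (simp add: a_def)
  have T: "T > 0"
    using design_index_pos[OF design] by simp
  have h: "h > 0"
    unfolding h_def using n T by (intro harm_dim_pos) auto
  have Q1: "Q 1 = h"
    using gegenbauer_even_at_1_nonzero[OF a T]
    by (simp add: Q_def Q_poly_def A_const_def h_def flip: a_def)
  with h show "Q 1 > 0" by simp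
  have "continuous_on {-1..1} Q"
    unfolding Q_def Q_poly_def a_def[symmetric] gegenbauer_even[OF less_imp_neq[OF a, symmetric]]
    by (intro continuous_intros)
  then have compact: "compact (Q ` {-1..1})"
    by (intro compact_continuous_image) auto
  have m_def': "m = (LEAST v. v \<in> Q ` {-1..1})"
    by (simp add: m_def c_const_def Q_def)
  show min: "m \<le> Q x" if "x \<in> {-1..1}" for x
    unfolding m_def' using that by (intro compact_LEAST(2)[OF compact]) auto
  have fin: "finite X"
    using design by (simp add: harmonic_index_design_def)
  have interval: "x \<bullet> y \<in> {-1..1}" if "x \<in> X" "y \<in> X" for x y
    using that design_norm[OF design] by (intro inner_unit_in_interval) auto
  have sum: "(\<Sum>x\<in>X - {y}. Q (x \<bullet> y)) = - h" if "y \<in> X" for y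
  proof -
    have "norm y = 1"
      using design_norm[OF design that] by (simp add: norm_eq_1)
    from design_zonal_sum[OF design this n] have "(\<Sum>x\<in>X. Q (x \<bullet> y)) = 0"
      by (simp add: Q_def)
    then show ?thesis
      using fin that design_norm[OF design that] Q1 by (simp add: sum.remove)
  qed
  obtain y0 where y0: "y0 \<in> X"
    using design by (auto simp: harmonic_index_design_def)
  \<comment> \<open>Otherwise nonnegative terms would add up to -h < 0.\<close>
  show m: "m < 0"
  proof (rule ccontr)
    assume "\<not> m < 0"
    then have "0 \<le> (\<Sum>x\<in>X - {y0}. Q (x \<bullet> y0))"
      using min interval y0 by (intro sum_nonneg) force
    with sum[OF y0] h show False by simp
  qed
  have cardX: "real (card X) = 1 + h / (- m)"
    using card by (simp add: b_const_def h_def m_def)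
  then have "real (card X) > 1"
    using h m by (simp add: divide_pos_neg)
  then show "card X \<ge> 2" by simp
  show "Q (x \<bullet> y) = m" if xy: "x \<in> X" "y \<in> X" "x \<noteq> y" for x y
  proof -
    \<comment> \<open>The \<open>card X - 1\<close> terms Q(<x, y>) also add up to -h and each is at
      least \<open>m\<close>, so all of them equal \<open>m\<close>.\<close>
    have "(real (card X) - 1) * m = - h"
      using m by (simp add: cardX)
    moreover have "real (card (X - {y})) = real (card X) - 1"
      using fin xy(2) \<open>card X \<ge> 2\<close> by (simp add: card_Diff_singleton of_nat_diff)
    ultimately have "(\<Sum>x\<in>X - {y}. Q (x \<bullet> y) - m) = 0"
      using sum[OF xy(2)] by (simp add: sum_subtractf del: card_Diff_insert)
    moreover have "0 \<le> Q (z \<bullet> y) - m" if "z \<in> X - {y}" for z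
      using that xy interval min by auto
    ultimately have "\<forall>z\<in>X - {y}. Q (z \<bullet> y) - m = 0"
      using fin by (subst (asm) sum_nonneg_eq_0_iff) auto
    with xy show ?thesis by auto
  qed
qed

lemma tight_design_dim_ge_3:
  fixes X :: "(real ^ 'n) set"
  assumes design: "harmonic_index_design (2 * T) X" and n: "CARD('n) \<ge> 3"
    and card: "real (card X) = b_const CARD('n) (2 * T)"
  shows "\<exists>\<alpha>\<in>{-1..1}. inner_products X = {\<alpha>, - \<alpha>}"
proof -
  define Q where "Q = Q_poly CARD('n) (2 * T)"
  define m where "m = - c_const CARD('n) (2 * T)"
  note tight = tight_design_inner_products[OF assms, folded Q_def m_def]
  define a where "a = (real CARD('n) - 2) / 2"
  have a: "a > 0"
    using n by (simp add: a_def)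
  have T: "T > 0"
    using design_index_pos[OF design] by simp
  define d where "d = (\<lambda>j. A_const CARD('n) (2 * T) * gegenbauer_coeff a T j)"
  have Q: "Q x = (\<Sum>j\<le>T. d j * x ^ (2 * j))" for x
    using a by (simp add: Q_def Q_poly_def gegenbauer_even d_def sum_distrib_left mult.assoc flip: a_def)
  have rec: "d (Suc j) * (real (2 * j + 2) * real (2 * j + 1))
      = - d j * (2 * real (T - j) * (2 * real T + 2 * real j + 2 * a))" if "j < T" for j
    using gegenbauer_coeff_rec[OF that, of a] by (simp only: d_def mult.assoc mult_minus_right minus_mult_left[symmetric])
  have I: "\<beta> \<in> {-1..1} \<and> Q \<beta> = m" if \<beta>: "\<beta> \<in> inner_products X" for \<beta>
  proof -
    obtain x y where "x \<in> X" "y \<in> X" "x \<noteq> y" "\<beta> = x \<bullet> y"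
      using \<beta> by (auto simp: inner_products_def)
    then show ?thesis
      using tight(5) inner_unit_in_interval[of x y] design_norm[OF design] by auto
  qed
  obtain x0 y0 where "x0 \<in> X" "y0 \<in> X" "x0 \<noteq> y0"
    using tight(4) by (auto simp: card_le_Suc_iff numeral_2_eq_2)
  then have \<alpha>: "x0 \<bullet> y0 \<in> inner_products X"
    by (auto simp: inner_products_def)
  define \<alpha> where "\<alpha> = x0 \<bullet> y0"
  have sub: "inner_products X \<subseteq> {\<alpha>, - \<alpha>}"
  proof
    fix \<beta> assume \<beta>: "\<beta> \<in> inner_products X"
    have "\<bar>\<beta>\<bar> = \<bar>\<alpha>\<bar>"
      by (rule even_gegenbauer_minimizer_unique[OF rec a T Q tight(2,1,3)])
        (use I[OF \<alpha>] I[OF \<beta>] in \<open>auto simp: \<alpha>_def\<close>)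
    then show "\<beta> \<in> {\<alpha>, - \<alpha>}" by (auto simp: abs_eq_iff)
  qed
  have "- \<alpha> \<in> inner_products X"
  proof (rule ccontr)
    \<comment> \<open>If only one sign occurs, then \<open>\<alpha>\<close> is nonzero and the
      design is equiangular.\<close>
    assume neg: "- \<alpha> \<notin> inner_products X"
    with \<alpha> have "\<alpha> \<noteq> 0" by (auto simp: \<alpha>_def)
    have equi: "x \<bullet> y = \<alpha>" if "x \<in> X" "y \<in> X" "x \<noteq> y" for x y
    proof -
      have "x \<bullet> y \<in> inner_products X"
        using that by (auto simp: inner_products_def)
      with sub neg show ?thesis by auto
    qed
    show False
    proof (cases "T = 1")
      \<comment> \<open>Here Q(x) = d_0 + d_1 x^2. A minimiser other than 0 forces d_1 <= 0, hence
        Q(1) <= m < 0, against Q(1) > 0.\<close>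
      case True
      have Q2: "Q x = d 0 + d 1 * x\<^sup>2" for x
        by (simp add: Q True)
      have m: "Q \<alpha> = m" "\<alpha> \<in> {-1..1}"
        using I[OF \<alpha>] by (auto simp: \<alpha>_def)
      have "d 1 * \<alpha>\<^sup>2 \<le> 0"
        using m tight(3)[of 0] by (simp add: Q2)
      then have "d 1 \<le> 0"
        using \<open>\<alpha> \<noteq> 0\<close> by (simp add: mult_le_0_iff)
      moreover have "\<alpha>\<^sup>2 \<le> 1"
        using m(2) by (simp add: abs_square_le_1 abs_le_iff)
      ultimately have "d 1 \<le> d 1 * \<alpha>\<^sup>2"
        by (simp add: mult_le_cancel_left1)
      then show False
        using m(1) tight(1,2) by (simp add: Q2)
    next
      case False
      then have "\<alpha> = 0"
        using T by (intro equiangular_design_orthogonal[OF design _ _ n equi]) auto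
      with \<open>\<alpha> \<noteq> 0\<close> show False by simp
    qed
  qed
  with sub \<alpha> have "inner_products X = {\<alpha>, - \<alpha>}"
    by (auto simp: \<alpha>_def)
  then show ?thesis
    using I[OF \<alpha>] by (auto simp: \<alpha>_def)
qed

theorem corollary4p1:
  fixes X :: "(real ^ 'n) set" and t :: nat
  assumes "CARD('n) \<ge> 2"
    and "even t"
    and "b_const CARD('n) t \<in> \<nat>"
    and "harmonic_index_design t X"
    and "real (card X) = b_const CARD('n) t"
  shows "\<exists>\<alpha>\<in>{-1..1}. inner_products X \<noteq> {} \<and> inner_products X \<subseteq> {\<alpha>, - \<alpha>} \<and>
           (CARD('n) \<ge> 3 \<longrightarrow> inner_products X = {\<alpha>, - \<alpha>})"
proof (cases "CARD('n) \<ge> 3")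
  case True
  obtain T where "t = 2 * T"
    using \<open>even t\<close> by (elim evenE)
  with tight_design_dim_ge_3[OF _ True] assms(4,5) show ?thesis
    by fastforce
next
  case False
  with assms(1) have n: "CARD('n) = 2" by simp
  have "card X = 2"
    using assms(5) b_const_2[OF design_index_pos[OF assms(4)]] by (simp add: n)
  then obtain x y where X: "X = {x, y}" "x \<noteq> y"
    by (auto simp: card_2_iff)
  then have "inner_products X = {x \<bullet> y}"
    by (auto simp: inner_products_def inner_commute)
  moreover have "x \<bullet> y \<in> {-1..1}"
    using design_norm[OF assms(4)] X by (intro inner_unit_in_interval) auto
  \<comment> \<open>Two points have a single inner product; the equality demanded in dimension at
    least 3 is vacuous here.\<close>
  ultimately show ?thesis
    using False by auto
qed

end
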